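(* The generating functions $l(z), s(z), r(z)$ of the Grover walk with one absorbing boundary at $-1$, namely $$l(z)=\sum_{t\ge 1}\langle -1,L|U(\Pi_{no}^{-1}U)^{t-1}|0,L\rangle z^t,\quad s(z)=\sum_{t\ge 1}\langle -1,L|U(\Pi_{no}^{-1}U)^{t-1}|0,S\rangle z^t,\quad r(z)=\sum_{t\ge 1}\langle -1,L|U(\Pi_{no}^{-1}U)^{t-1}|0,R\rangle z^t,$$ are given by $$l(z)=\frac{-3-4z-3z^2+(1+z)\Delta}{2z},\qquad s(z)=\frac{-3-z+\Delta}{2z},\qquad r(z)=\frac{3-2z+3z^2+(-1+z)\Delta}{4z},$$ where $\Delta=\sqrt{9+6z+9z^2}$ (the branch with $\Delta=3$ at $z=0$, so that each right-hand side has a Taylor expansion at $0$).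
   Context: The Grover walk acts on the Hilbert space $\mathcal H=\ell^2(\mathbb Z)\otimes\mathbb C^3$ with orthonormal basis $|m,c\rangle=|m\rangle\otimes|c\rangle$, $m\in\mathbb Z$, $c\in\{L,S,R\}$. The evolution operator is $U=\mathrm{Sh}\cdot(I\otimes G)$, where, in the ordered basis $(L,S,R)$, $G=\frac13\begin{pmatrix}-1&2&2\\2&-1&2\\2&2&-1\end{pmatrix}$, and the shift is $\mathrm{Sh}|m,L\rangle=|m-1,L\rangle$, $\mathrm{Sh}|m,S\rangle=|m,S\rangle$, $\mathrm{Sh}|m,R\rangle=|m+1,R\rangle$. For $n\in\mathbb Z$, $\Pi_{yes}^{n}=|n\rangle\langle n|\otimes I$ and $\Pi_{no}^{n}=I-\Pi_{yes}^{n}$. The generating functions are power series in $z$. *)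

theory Defs
  imports "HOL-Complex_Analysis.Complex_Analysis"
begin

section \<open>Square-summable complex functions\<close>

text \<open>
  The tensor product of \<open>\<ell>\<^sup>2(\<int>)\<close> with \<open>\<complex>\<^sup>3\<close> is identified with \<open>\<ell>\<^sup>2(\<int> \<times> {L, S, R})\<close>; the basis
  vector \<open>|m\<rangle> \<otimes> |c\<rangle>\<close> becomes \<open>ket (m, c)\<close>.
\<close>

lemma sq_summable_add:
  fixes f g :: "'a \<Rightarrow> complex"
  assumes "(\<lambda>x. (cmod (f x))\<^sup>2) summable_on A" "(\<lambda>x. (cmod (g x))\<^sup>2) summable_on A"
  shows "(\<lambda>x. (cmod (f x + g x))\<^sup>2) summable_on A"
proof (rule summable_on_comparison_test)
  show "(\<lambda>x. 2 * (cmod (f x))\<^sup>2 + 2 * (cmod (g x))\<^sup>2) summable_on A"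
    using assms by (intro summable_on_add summable_on_cmult_right)
  show "(cmod (f x + g x))\<^sup>2 \<le> 2 * (cmod (f x))\<^sup>2 + 2 * (cmod (g x))\<^sup>2" for x
  proof -
    have "(cmod (f x + g x))\<^sup>2 \<le> (cmod (f x) + cmod (g x))\<^sup>2"
      by (intro power_mono norm_triangle_ineq) auto
    also have "\<dots> \<le> 2 * (cmod (f x))\<^sup>2 + 2 * (cmod (g x))\<^sup>2"
      using sum_squares_bound[of "cmod (f x)" "cmod (g x)"] by (simp add: power2_sum)
    finally show ?thesis .
  qed
qed auto

lemma sq_summable_cmult:
  fixes f :: "'a \<Rightarrow> complex"
  assumes "(\<lambda>x. (cmod (f x))\<^sup>2) summable_on A"
  shows "(\<lambda>x. (cmod (c * f x))\<^sup>2) summable_on A"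
  using summable_on_cmult_right[OF assms, of "(cmod c)\<^sup>2"]
  by (simp add: norm_mult power_mult_distrib)

typedef 'a ell2 = "{\<psi> :: 'a \<Rightarrow> complex. (\<lambda>x. (cmod (\<psi> x))\<^sup>2) summable_on UNIV}"
  morphisms coord Abs_ell2
  by (rule exI[of _ "\<lambda>_. 0"]) simp

setup_lifting type_definition_ell2

lemma ell2_eqI: "(\<And>x. coord \<psi> x = coord \<phi> x) \<Longrightarrow> \<psi> = \<phi>"
  by (simp add: coord_inject[symmetric] fun_eq_iff)

instantiation ell2 :: (type) real_vector
begin

lift_definition zero_ell2 :: "'a ell2" is "\<lambda>_. 0" by simp

lift_definition plus_ell2 :: "'a ell2 \<Rightarrow> 'a ell2 \<Rightarrow> 'a ell2" is "\<lambda>\<psi> \<phi> x. \<psi> x + \<phi> x"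
  by (rule sq_summable_add)

lift_definition uminus_ell2 :: "'a ell2 \<Rightarrow> 'a ell2" is "\<lambda>\<psi> x. - \<psi> x" by simp

lift_definition minus_ell2 :: "'a ell2 \<Rightarrow> 'a ell2 \<Rightarrow> 'a ell2" is "\<lambda>\<psi> \<phi> x. \<psi> x - \<phi> x"
  subgoal for \<psi> \<phi> using sq_summable_add[of \<psi> UNIV "\<lambda>x. - \<phi> x"] by simp
  done

lift_definition scaleR_ell2 :: "real \<Rightarrow> 'a ell2 \<Rightarrow> 'a ell2" is "\<lambda>r \<psi> x. r *\<^sub>R \<psi> x"
  unfolding scaleR_conv_of_real by (rule sq_summable_cmult)

instance
  by standard (transfer; simp add: fun_eq_iff algebra_simps)+

end

lift_definition ket :: "'a \<Rightarrow> 'a ell2" is "\<lambda>a x. if x = a then 1 else 0"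
  subgoal for a
    by (rule finite_nonzero_values_imp_summable_on, rule finite_subset[of _ "{a}"]) auto
  done

definition braket :: "'a ell2 \<Rightarrow> 'a ell2 \<Rightarrow> complex" where
  "braket \<phi> \<psi> = (\<Sum>\<^sub>\<infinity>x. cnj (coord \<phi> x) * coord \<psi> x)"

lemma braket_ket: "braket (ket a) \<psi> = coord \<psi> a"
proof -
  have "braket (ket a) \<psi> = (\<Sum>\<^sub>\<infinity>x\<in>{a}. cnj (coord (ket a) x) * coord \<psi> x)"
    unfolding braket_def by (rule infsum_cong_neutral) (auto simp: ket.rep_eq)
  then show ?thesis by (simp add: ket.rep_eq)
qed


section \<open>The Grover walk\<close>

datatype chirality = L_dir | S_dir | R_dir

lemma UNIV_chirality: "(UNIV :: chirality set) = {L_dir, S_dir, R_dir}"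
  using chirality.exhaust by auto

instance chirality :: finite
  by standard (simp add: UNIV_chirality)

type_synonym walk_state = "(int \<times> chirality) ell2"

lemma sq_summable_fibre_iff:
  fixes \<psi> :: "int \<times> chirality \<Rightarrow> complex"
  shows "(\<lambda>x. (cmod (\<psi> x))\<^sup>2) summable_on UNIV \<longleftrightarrow>
         (\<forall>c. (\<lambda>m. (cmod (\<psi> (m, c)))\<^sup>2) summable_on UNIV)"
proof -
  have fibre: "(\<lambda>x. (cmod (\<psi> x))\<^sup>2) summable_on range (\<lambda>m. (m, c)) \<longleftrightarrow>
               (\<lambda>m. (cmod (\<psi> (m, c)))\<^sup>2) summable_on UNIV" for c
    by (subst summable_on_reindex) (auto simp: inj_on_def o_def)
  have un: "(UNIV :: (int \<times> chirality) set) =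
      range (\<lambda>m. (m, L_dir)) \<union> range (\<lambda>m. (m, S_dir)) \<union> range (\<lambda>m. (m, R_dir))"
    using UNIV_chirality by (auto simp: image_iff)
  show ?thesis
  proof
    assume "(\<lambda>x. (cmod (\<psi> x))\<^sup>2) summable_on UNIV"
    then show "\<forall>c. (\<lambda>m. (cmod (\<psi> (m, c)))\<^sup>2) summable_on UNIV"
      using fibre summable_on_subset_banach by blast
  next
    assume "\<forall>c. (\<lambda>m. (cmod (\<psi> (m, c)))\<^sup>2) summable_on UNIV"
    then show "(\<lambda>x. (cmod (\<psi> x))\<^sup>2) summable_on UNIV"
      unfolding un fibre[symmetric] by (intro summable_on_Un_disjoint) auto
  qed
qed

lemma sq_summable_translate:
  fixes f :: "int \<Rightarrow> complex"
  assumes "(\<lambda>m. (cmod (f m))\<^sup>2) summable_on UNIV"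
  shows "(\<lambda>m. (cmod (f (m + k)))\<^sup>2) summable_on UNIV"
proof -
  have "bij (\<lambda>m :: int. m + k)"
    by (rule bij_betwI[of _ _ _ "\<lambda>m. m - k"]) auto
  from summable_on_reindex_bij_betw[OF this, of "\<lambda>m. (cmod (f m))\<^sup>2"] assms
  show ?thesis by simp
qed

definition grover_matrix :: "chirality \<Rightarrow> chirality \<Rightarrow> real" where
  "grover_matrix c d = (if c = d then - 1 / 3 else 2 / 3)"

text \<open>The operator \<open>I \<otimes> G\<close>; see \<open>coin_op_ket\<close> for its action on the basis.\<close>

lift_definition coin_op :: "walk_state \<Rightarrow> walk_state" is
  "\<lambda>\<psi> (m, c). \<Sum>d\<in>UNIV. complex_of_real (grover_matrix c d) * \<psi> (m, d)"
  unfolding sq_summable_fibre_iff UNIV_chirality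
  by (auto intro!: sq_summable_add sq_summable_cmult)

text \<open>
  The shift in coordinates: the amplitude arriving at \<open>(m, L_dir)\<close> comes from \<open>(m + 1, L_dir)\<close>.
  See \<open>shift_ket\<close> for its action on the basis.
\<close>

lift_definition shift :: "walk_state \<Rightarrow> walk_state" is
  "\<lambda>\<psi> (m, c). case c of L_dir \<Rightarrow> \<psi> (m + 1, L_dir) | S_dir \<Rightarrow> \<psi> (m, S_dir) | R_dir \<Rightarrow> \<psi> (m - 1, R_dir)"
  subgoal for \<psi>
    unfolding sq_summable_fibre_iff
    apply (rule allI)
    subgoal for c
      using sq_summable_translate[of "\<lambda>m. \<psi> (m, L_dir)" 1]
        sq_summable_translate[of "\<lambda>m. \<psi> (m, R_dir)" "- 1"]
      by (cases c) auto
    done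
  done

definition U :: "walk_state \<Rightarrow> walk_state" where
  "U \<psi> = shift (coin_op \<psi>)"

lift_definition Pi_yes :: "int \<Rightarrow> walk_state \<Rightarrow> walk_state" is
  "\<lambda>n \<psi> (m, c). if m = n then \<psi> (m, c) else 0"
  subgoal for n \<psi>
    unfolding sq_summable_fibre_iff
    by (auto intro!: finite_nonzero_values_imp_summable_on finite_subset[of _ "{n}"] split: if_splits)
  done

definition Pi_no :: "int \<Rightarrow> walk_state \<Rightarrow> walk_state" where
  "Pi_no n \<psi> = \<psi> - Pi_yes n \<psi>"

lemma coin_op_ket: "coin_op (ket (m, d)) = (\<Sum>c\<in>UNIV. grover_matrix c d *\<^sub>R ket (m, c))"
proof (rule ell2_eqI)
  fix x :: "int \<times> chirality"
  obtain k c where x: "x = (k, c)" by (cases x)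
  show "coord (coin_op (ket (m, d))) x = coord (\<Sum>c\<in>UNIV. grover_matrix c d *\<^sub>R ket (m, c)) x"
    unfolding x
    by (cases c; cases d)
      (simp_all add: coin_op.rep_eq ket.rep_eq plus_ell2.rep_eq scaleR_ell2.rep_eq
        UNIV_chirality zero_ell2.rep_eq scaleR_conv_of_real)
qed

lemma shift_ket:
  "shift (ket (m, L_dir)) = ket (m - 1, L_dir)"
  "shift (ket (m, S_dir)) = ket (m, S_dir)"
  "shift (ket (m, R_dir)) = ket (m + 1, R_dir)"
  by (rule ell2_eqI, auto simp: shift.rep_eq ket.rep_eq split: prod.splits chirality.splits)+

lemma Pi_yes_ket: "Pi_yes n (ket (m, c)) = (if m = n then ket (m, c) else 0)"
  by (rule ell2_eqI)
    (auto simp: Pi_yes.rep_eq ket.rep_eq zero_ell2.rep_eq split: prod.splits)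

lemma linear_walk_operators:
  "linear coin_op" "linear shift" "linear U" "linear (Pi_yes n)" "linear (Pi_no n)"
proof -
  show coin: "linear coin_op"
    by (rule linearI; rule ell2_eqI)
      (auto simp: coin_op.rep_eq plus_ell2.rep_eq scaleR_ell2.rep_eq UNIV_chirality
        algebra_simps split: prod.splits)
  show shift: "linear shift"
    by (rule linearI; rule ell2_eqI)
      (auto simp: shift.rep_eq plus_ell2.rep_eq scaleR_ell2.rep_eq
        split: prod.splits chirality.splits)
  show "linear U"
    using linear_compose[OF coin shift] by (simp add: U_def[abs_def] o_def)
  show yes: "linear (Pi_yes n)"
    by (rule linearI; rule ell2_eqI)
      (auto simp: Pi_yes.rep_eq plus_ell2.rep_eq scaleR_ell2.rep_eq split: prod.splits)
  show "linear (Pi_no n)"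
    using linear_compose_sub[OF linear_id yes] by (simp add: Pi_no_def[abs_def])
qed

text \<open>
  The amplitude of first reaching the boundary at \<open>-1\<close> at time \<open>t \<ge> 1\<close>, starting from \<open>|0, c\<rangle>\<close>, and
  its generating function. For \<open>c\<close> equal to \<open>L_dir\<close>, \<open>S_dir\<close>, \<open>R_dir\<close> the latter is \<open>l\<close>, \<open>s\<close>, \<open>r\<close>.
\<close>

definition absorption_amplitude :: "chirality \<Rightarrow> nat \<Rightarrow> complex" where
  "absorption_amplitude c t =
     braket (ket (- 1, L_dir)) (U (((\<lambda>\<psi>. Pi_no (- 1) (U \<psi>)) ^^ (t - 1)) (ket (0, c))))"

definition absorption_gf :: "chirality \<Rightarrow> complex fps" where
  "absorption_gf c = Abs_fps (\<lambda>t. if t \<ge> 1 then absorption_amplitude c t else 0)"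

text \<open>
  The square root is the principal one; since \<open>csqrt 9 = 3\<close>, it is the branch with value \<open>3\<close> at \<open>0\<close>,
  and it is holomorphic near \<open>0\<close>.
\<close>

definition Delta :: "complex \<Rightarrow> complex" where
  "Delta z = csqrt (9 + 6 * z + 9 * z\<^sup>2)"

lemma Delta_0: "Delta 0 = 3"
proof -
  have "csqrt (complex_of_real 9) = complex_of_real (sqrt 9)"
    by (rule of_real_sqrt[symmetric]) simp
  then show ?thesis by (simp add: Delta_def)
qed

text \<open>
  The closed forms in the theorem have a removable singularity at \<open>0\<close>. They are compared with the
  power series through Laurent expansions at \<open>0\<close>, which are insensitive to the value at \<open>0\<close>; because
  the Laurent series comes from a power series, this is the Taylor expansion of the continued function.
\<close>

end

theory Submission
  imports Defs
begin

text \<open>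
  Conditioning on the first step and on the first visit to each of the sites between the starting
  point and the boundary gives the quadratic system
  \<open>3l = z(-1 + 2s + 2rl)\<close>, \<open>3s = z(2 - s + 2rl)\<close>, \<open>3r = z(2 + 2s - rl)\<close>, which the closed forms
  satisfy because \<open>\<Delta>\<^sup>2 = 9 + 6z + 9z\<^sup>2\<close>. Conversely, if \<open>g\<close> solves the system, then \<open>g\<^sub>c l\<^sup>m\<close>
  satisfies the one-step recurrence for the absorption amplitudes of the walk started at \<open>|m, c\<rangle>\<close>,
  and this recurrence determines all coefficients.
\<close>

text \<open>\<open>t\<close> counts only the steps that end in a projection; the final
  \<open>U\<close> comes on top, so this is the amplitude for absorption at time
  \<open>t + 1\<close>.\<close>

definition amplitude_from :: "walk_state \<Rightarrow> nat \<Rightarrow> complex" where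
  "amplitude_from \<psi> t = coord (U (((\<lambda>\<psi>. Pi_no (- 1) (U \<psi>)) ^^ t) \<psi>)) (- 1, L_dir)"

lemma linear_amplitude_from: "linear (\<lambda>\<psi>. amplitude_from \<psi> t)"
proof -
  let ?A = "\<lambda>\<psi>. Pi_no (- 1) (U \<psi>)"
  have A: "linear ?A"
    using linear_compose[OF linear_walk_operators(3) linear_walk_operators(5)] by (simp add: o_def)
  have An: "linear (?A ^^ t)" for t
  proof (induction t)
    case 0
    then show ?case using linear_id by (simp add: id_def)
  next
    case (Suc t)
    from linear_compose[OF this A] show ?case by (simp add: o_def)
  qed
  from linear_compose[OF An linear_walk_operators(3)]
  have V: "linear (\<lambda>\<psi>. U ((?A ^^ t) \<psi>))" by (simp add: o_def)
  show ?thesis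
    unfolding amplitude_from_def
    by (intro linearI)
      (simp_all add: linear_add[OF V] linear_scale[OF V] plus_ell2.rep_eq scaleR_ell2.rep_eq)
qed

lemma absorption_amplitude_Suc:
  "absorption_amplitude c (Suc t) = amplitude_from (ket (0, c)) t"
  by (simp add: absorption_amplitude_def amplitude_from_def braket_ket)

lemma U_ket:
  "U (ket (m, c)) = grover_matrix L_dir c *\<^sub>R ket (m - 1, L_dir)
    + grover_matrix S_dir c *\<^sub>R ket (m, S_dir) + grover_matrix R_dir c *\<^sub>R ket (m + 1, R_dir)"
  by (simp add: U_def coin_op_ket UNIV_chirality shift_ket
      linear_add[OF linear_walk_operators(2)] linear_scale[OF linear_walk_operators(2)])

lemma Pi_no_ket: "Pi_no n (ket (m, c)) = (if m = n then 0 else ket (m, c))"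
  by (simp add: Pi_no_def Pi_yes_ket)

lemma amplitude_from_ket_0:
  "amplitude_from (ket (int m, c)) 0 = (if m = 0 then of_real (grover_matrix L_dir c) else 0)"
  by (simp add: amplitude_from_def U_ket plus_ell2.rep_eq scaleR_ell2.rep_eq ket.rep_eq
      scaleR_conv_of_real)

text \<open>Split off the first step and use linearity on its three outcomes. A left move from
  \<open>m = 0\<close> lands on the boundary and is projected away; the \<open>if\<close> also
  guards the truncated \<open>m - 1\<close>.\<close>

lemma amplitude_from_ket_Suc:
  "amplitude_from (ket (int m, c)) (Suc t) =
     of_real (grover_matrix L_dir c) *
       (if m = 0 then 0 else amplitude_from (ket (int (m - 1), L_dir)) t)
     + of_real (grover_matrix S_dir c) * amplitude_from (ket (int m, S_dir)) t
     + of_real (grover_matrix R_dir c) * amplitude_from (ket (int (Suc m), R_dir)) t"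
proof -
  have "amplitude_from (ket (int m, c)) (Suc t) =
      amplitude_from (Pi_no (- 1) (U (ket (int m, c)))) t"
    by (simp add: amplitude_from_def funpow_Suc_right del: funpow.simps)
  also have "Pi_no (- 1) (U (ket (int m, c))) =
      grover_matrix L_dir c *\<^sub>R (if m = 0 then 0 else ket (int (m - 1), L_dir))
      + grover_matrix S_dir c *\<^sub>R ket (int m, S_dir)
      + grover_matrix R_dir c *\<^sub>R ket (int (Suc m), R_dir)"
    by (simp add: U_ket linear_add[OF linear_walk_operators(5)]
        linear_scale[OF linear_walk_operators(5)] Pi_no_ket of_nat_diff add.commute)
  finally show ?thesis
    by (simp add: linear_add[OF linear_amplitude_from] linear_scale[OF linear_amplitude_from]
        linear_0[OF linear_amplitude_from] scaleR_conv_of_real)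
qed

lemma absorption_gf_eqI:
  fixes g :: "chirality \<Rightarrow> complex fps"
  assumes L: "3 * g L_dir = fps_X * (- 1 + 2 * g S_dir + 2 * g R_dir * g L_dir)"
    and S: "3 * g S_dir = fps_X * (2 - g S_dir + 2 * g R_dir * g L_dir)"
    and R: "3 * g R_dir = fps_X * (2 + 2 * g S_dir - g R_dir * g L_dir)"
  shows "absorption_gf c = g c"
proof -
  let ?G = "\<lambda>d c. of_real (grover_matrix d c) :: complex"
  \<comment> \<open>Division by 3 turns the coefficients into column \<open>c\<close> of the Grover
    matrix, so one formula covers all chiralities.\<close>
  have sys: "g c = fps_X * (fps_const (?G L_dir c) + fps_const (?G S_dir c) * g S_dir
      + fps_const (?G R_dir c) * (g R_dir * g L_dir))" for c
  proof -
    have three: "(3 :: complex fps) = fps_const 3"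
      by (simp add: numeral_fps_const)
    have cancel: "f = fps_X * h" if "3 * f = fps_X * (3 * h)" for f h :: "complex fps"
      using that by (simp add: mult.left_commute[of fps_X 3])
    have th: "3 * fps_const (- (1 / 3)) = (- 1 :: complex fps)"
      "3 * fps_const (2 / 3) = (2 :: complex fps)"
      unfolding three by (simp_all add: fps_const_neg[symmetric] numeral_fps_const del: fps_const_neg)
    have th': "3 * (fps_const (- (1 / 3)) * f) = - f" "3 * (fps_const (2 / 3) * f) = 2 * f"
      for f :: "complex fps"
      by (simp_all add: th mult.assoc[symmetric])
    show ?thesis
      by (rule cancel, cases c)
        (simp_all add: grover_matrix_def L S R distrib_left th th' mult.assoc)
  qed
  have step: "g c * g L_dir ^ m = fps_X * (fps_const (?G L_dir c) * g L_dir ^ m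
      + fps_const (?G S_dir c) * (g S_dir * g L_dir ^ m)
      + fps_const (?G R_dir c) * (g R_dir * g L_dir ^ Suc m))" for c m
    by (subst sys[of c]) (simp add: algebra_simps)
  have zero: "g c $ 0 = 0" for c
    by (subst sys) simp
  \<comment> \<open>The factor \<open>fps_X\<close> in \<open>step\<close> lowers the coefficient
    index by one, which drives the induction; \<open>m\<close> stays arbitrary because a right move
    raises it.\<close>
  have coeff: "amplitude_from (ket (int m, c)) t = (g c * g L_dir ^ m) $ Suc t" for m c t
  proof (induction t arbitrary: m c)
    case 0
    show ?case
      by (subst step) (simp add: amplitude_from_ket_0 zero power_0_left)
  next
    case (Suc t)
    \<comment> \<open>For \<open>m = 0\<close> the right side is a positive-index coefficient of 1:
      immediate absorption contributes at time 1 only.\<close>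
    have "(if m = 0 then 0 else amplitude_from (ket (int (m - 1), L_dir)) t)
        = (g L_dir ^ m) $ Suc t"
      by (cases m) (simp_all add: Suc.IH)
    then show ?case
      by (subst step) (simp add: amplitude_from_ket_Suc Suc.IH del: power_Suc of_nat_Suc)
  qed
  show ?thesis
  proof (rule fps_ext)
    fix n
    show "absorption_gf c $ n = g c $ n"
      using coeff[of 0 c "n - 1"]
      by (cases n) (simp_all add: absorption_gf_def absorption_amplitude_Suc zero)
  qed
qed

text \<open>The radicand is 9 at the origin, off the branch cut of \<open>csqrt\<close>, so
  \<open>Delta\<close> is analytic there; uniqueness of expansions then gives the square of
  \<open>D\<close>.\<close>

lemma Delta_has_fps_expansion:
  obtains D :: "complex fps"
  where "Delta has_fps_expansion D" "D\<^sup>2 = 9 + 6 * fps_X + 9 * fps_X\<^sup>2" "D $ 0 = 3"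
proof -
  have "(\<lambda>z. csqrt (9 + 6 * z + 9 * z\<^sup>2)) analytic_on {0}"
    by (intro analytic_intros) (auto simp: complex_nonpos_Reals_iff)
  then have "Delta analytic_on {0}"
    by (simp add: Delta_def[abs_def])
  then obtain D where D: "Delta has_fps_expansion D"
    using analytic_at_imp_has_fps_expansion_0 by blast
  have "(\<lambda>z. (Delta z)\<^sup>2) has_fps_expansion D\<^sup>2"
    by (intro fps_expansion_intros D)
  moreover have "(\<lambda>z. (Delta z)\<^sup>2) has_fps_expansion 9 + 6 * fps_X + 9 * fps_X\<^sup>2"
    unfolding Delta_def power2_csqrt by (intro fps_expansion_intros)
  ultimately have "D\<^sup>2 = 9 + 6 * fps_X + 9 * fps_X\<^sup>2"
    by (rule fps_expansion_unique_complex)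
  moreover have "D $ 0 = 3"
    using has_fps_expansion_imp_0_eq_fps_nth_0[OF D] by (simp add: Delta_0)
  ultimately show ?thesis using that D by blast
qed

text \<open>The factor \<open>fps_X\<close> of \<open>F\<close> cancels the pole of
  \<open>1 / (a * z)\<close>, so the quotient expands into a genuine power series.\<close>

lemma has_laurent_expansion_divide_linear:
  fixes f :: "complex \<Rightarrow> complex" and F G :: "complex fps"
  assumes "f has_fps_expansion F" and F: "F = fps_const a * fps_X * G" and a: "a \<noteq> 0"
  shows "(\<lambda>z. f z / (a * z)) has_laurent_expansion fps_to_fls G"
proof -
  have "(\<lambda>z. a * z) has_fps_expansion fps_const a * fps_X"
    by (intro fps_expansion_intros)
  with assms(1) have "(\<lambda>z. f z / (a * z)) has_laurent_expansion
      fps_to_fls F / fps_to_fls (fps_const a * fps_X)"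
    by (intro has_laurent_expansion_divide has_laurent_expansion_fps)
  also have "fps_to_fls F / fps_to_fls (fps_const a * fps_X) = fps_to_fls G"
    using a by (simp add: F fls_times_fps_to_fls)
  finally show ?thesis .
qed

theorem theorem1:
  shows "(\<lambda>z. (- 3 - 4 * z - 3 * z\<^sup>2 + (1 + z) * Delta z) / (2 * z))
           has_laurent_expansion fps_to_fls (absorption_gf L_dir) \<and>
         (\<lambda>z. (- 3 - z + Delta z) / (2 * z))
           has_laurent_expansion fps_to_fls (absorption_gf S_dir) \<and>
         (\<lambda>z. (3 - 2 * z + 3 * z\<^sup>2 + (- 1 + z) * Delta z) / (4 * z))
           has_laurent_expansion fps_to_fls (absorption_gf R_dir)"
proof -
  obtain D :: "complex fps" where D: "Delta has_fps_expansion D"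
    and D2: "D\<^sup>2 = 9 + 6 * fps_X + 9 * fps_X\<^sup>2" and D0: "D $ 0 = 3"
    using Delta_has_fps_expansion .
  let ?X = "fps_X :: complex fps"
  define NL where "NL = - 3 - 4 * ?X - 3 * ?X\<^sup>2 + (1 + ?X) * D"
  define NS where "NS = - 3 - ?X + D"
  define NR where "NR = 3 - 2 * ?X + 3 * ?X\<^sup>2 + (- 1 + ?X) * D"
  have quot: "\<exists>G. N = fps_const a * ?X * G" if "N $ 0 = 0" "a \<noteq> 0" for N :: "complex fps" and a
  proof -
    have "N = fps_const a * ?X * (fps_const (1 / a) * fps_shift 1 N)"
      using that by (intro fps_ext) (simp add: mult.assoc)
    then show ?thesis by blast
  qed
  \<comment> \<open>Here the branch matters: with \<open>D $ 0 = 3\<close> the constant terms -3 +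
    3, -3 + 3 and 3 - 3 vanish, whereas -3 would leave a pole.\<close>
  obtain gL where NL: "NL = fps_const 2 * ?X * gL"
    using quot[of NL 2] by (auto simp: NL_def D0)
  obtain gS where NS: "NS = fps_const 2 * ?X * gS"
    using quot[of NS 2] by (auto simp: NS_def D0)
  obtain gR where NR: "NR = fps_const 4 * ?X * gR"
    using quot[of NR 4] by (auto simp: NR_def D0)
  define g where "g = case_chirality gL gS gR"
  note N = NL[unfolded NL_def] NS[unfolded NS_def] NR[unfolded NR_def]
  have gf: "absorption_gf c = g c" for c
  proof (rule absorption_gf_eqI)
    \<comment> \<open>After multiplication by \<open>4 * ?X\<close>, all terms become polynomials in
      \<open>?X\<close> and \<open>D\<close>, the quadratic one through
      \<open>NR * NL = 8 * ?X\<^sup>2 * gR * gL\<close>; \<open>D2\<close> then eliminates the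
      square of \<open>D\<close>.\<close>
    have cancel: "f = h" if "4 * ?X * f = 4 * ?X * h" for f h :: "complex fps"
      using that by simp
    note N' = N[folded numeral_fps_const]
    show "3 * g L_dir = fps_X * (- 1 + 2 * g S_dir + 2 * g R_dir * g L_dir)"
      unfolding g_def chirality.case by (rule cancel) (use N' D2 in algebra)
    show "3 * g S_dir = fps_X * (2 - g S_dir + 2 * g R_dir * g L_dir)"
      unfolding g_def chirality.case by (rule cancel) (use N' D2 in algebra)
    show "3 * g R_dir = fps_X * (2 + 2 * g S_dir - g R_dir * g L_dir)"
      unfolding g_def chirality.case by (rule cancel) (use N' D2 in algebra)
  qed
  show ?thesis
    unfolding gf g_def chirality.case
    by (intro conjI has_laurent_expansion_divide_linear[OF _ NL]
        has_laurent_expansion_divide_linear[OF _ NS] has_laurent_expansion_divide_linear[OF _ NR])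
      (auto simp: NL_def NS_def NR_def intro!: fps_expansion_intros D)
qed

end
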